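(* Let $\alpha\in[0,1)$. In a market with multiple platforms, all of whose transaction fees are at most the cap $\alpha$, the Price of Anarchy of Platform Equilibrium is at most $\frac{2-\alpha}{1-\alpha}$: for every such market and every (pure or mixed) Platform Equilibrium, the optimal welfare $W^\star$ is at most $\frac{2-\alpha}{1-\alpha}$ times the (expected) social welfare of the equilibrium.
   Context: There is a finite set $B$ of unit-demand buyers, a finite set $S$ of sellers each owning one item, values $v_{ij}\ge0$ of buyer $i$ for seller $j$'s item, and a bipartite graph $G$ between $B$ and $S$ of pairs that can transact directly. For a bipartite graph $G'$, $W(S',B',G')$ denotes the maximum of $\sum v_{ij}$ over matchings between $B'\subseteq B$ and $S'\subseteq S$ that use only edges of $G'$. There is a finite set of platforms $F=\{f_1,\dots,f_R\}$; platform $f_r$ has a set of buyers $B_r\subseteq B$ (a buyer may be on several platforms) and a transaction fee $\alpha_r\in[0,\alpha]$. Each seller $j$ simultaneously chooses a set $F_j\subseteq F$ of platforms to join (possibly empty, possibly several). The resulting graph $G'$ consists of $G$ together with all edges between $j$ and buyers in $\bigcup_{f_r\in F_j}B_r$, for every seller $j$. The market clears in a competitive (Walrasian) equilibrium on $G'$: a welfare-maximizing allocation on $G'$ is implemented, with the maximum competitive prices $p_j=W(S,B,G')-W(S\setminus\{j\},B,G')$; the social welfare is $W(S,B,G')$. If seller $j$ transacts with a buyer $i$ through a platform edge, $j$ pays a fraction $\alpha_r$ of its price $p_j$ to a platform $f_r\in F_j$ with $i\in B_r$, choosing the one of lowest fee if there are several, so its utility is $(1-\alpha_r)p_j$; if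 $j$ transacts through a direct link of $G$ it pays no fee and has utility $p_j$; if it does not transact its utility is $0$. A Platform Equilibrium is a Nash equilibrium (in pure or independently mixed strategies, utilities taken in expectation) of this game among the sellers. The optimal welfare $W^\star$ is the maximum welfare when every seller joins every platform, i.e. $W(S,B,G^{\mathrm{all}})$ where $G^{\mathrm{all}}$ is $G$ together with all edges between $S$ and $\bigcup_r B_r$ (the complete bipartite graph when every buyer is on some platform). *)

theory Defs
  imports "HOL-Probability.Product_PMF"
begin

text \<open>
  Graphs are sets of pairs \<open>(i, j)\<close> of a buyer \<open>i\<close> and a seller \<open>j\<close>; the item of seller \<open>j\<close> is
  identified with \<open>j\<close>. \<open>users M r\<close> is the set of buyers on platform \<open>r\<close>.
\<close>

record ('b, 's, 'f) market =
  buyers :: "'b set"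
  sellers :: "'s set"
  val :: "'b \<Rightarrow> 's \<Rightarrow> real"
  direct :: "('b \<times> 's) set"
  platforms :: "'f set"
  users :: "'f \<Rightarrow> 'b set"
  fee :: "'f \<Rightarrow> real"

definition capped_market :: "real \<Rightarrow> ('b, 's, 'f) market \<Rightarrow> bool" where
  "capped_market \<alpha> M \<longleftrightarrow>
     finite (buyers M) \<and> finite (sellers M) \<and> finite (platforms M) \<and>
     (\<forall>i\<in>buyers M. \<forall>j\<in>sellers M. 0 \<le> val M i j) \<and>
     direct M \<subseteq> buyers M \<times> sellers M \<and>
     (\<forall>r\<in>platforms M. users M r \<subseteq> buyers M) \<and>
     (\<forall>r\<in>platforms M. 0 \<le> fee M r \<and> fee M r \<le> \<alpha>)"

definition matchings :: "'s set \<Rightarrow> 'b set \<Rightarrow> ('b \<times> 's) set \<Rightarrow> ('b \<times> 's) set set" where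
  "matchings S' B' E = {m. m \<subseteq> E \<inter> (B' \<times> S') \<and> inj_on fst m \<and> inj_on snd m}"

definition weight :: "('b, 's, 'f) market \<Rightarrow> ('b \<times> 's) set \<Rightarrow> real" where
  "weight M m = (\<Sum>(i, j)\<in>m. val M i j)"

definition W :: "('b, 's, 'f) market \<Rightarrow> 's set \<Rightarrow> 'b set \<Rightarrow> ('b \<times> 's) set \<Rightarrow> real" where
  "W M S' B' E = Max (weight M ` matchings S' B' E)"

text \<open>
  A pure strategy profile assigns to each seller the set of platforms joined; it is \<open>{}\<close> outside
  \<open>sellers M\<close>, so that profiles are exactly the possible outcomes of \<open>play\<close> below.
\<close>

definition profiles :: "('b, 's, 'f) market \<Rightarrow> ('s \<Rightarrow> 'f set) set" where
  "profiles M = PiE_dflt (sellers M) {} (\<lambda>_. Pow (platforms M))"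

definition market_graph :: "('b, 's, 'f) market \<Rightarrow> ('s \<Rightarrow> 'f set) \<Rightarrow> ('b \<times> 's) set" where
  "market_graph M p = direct M \<union> {(i, j). j \<in> sellers M \<and> i \<in> (\<Union>r\<in>p j. users M r)}"

definition welfare :: "('b, 's, 'f) market \<Rightarrow> ('s \<Rightarrow> 'f set) \<Rightarrow> real" where
  "welfare M p = W M (sellers M) (buyers M) (market_graph M p)"

definition optimal_welfare :: "('b, 's, 'f) market \<Rightarrow> real" where
  "optimal_welfare M = W M (sellers M) (buyers M) (market_graph M (\<lambda>_. platforms M))"

definition price :: "('b, 's, 'f) market \<Rightarrow> ('s \<Rightarrow> 'f set) \<Rightarrow> 's \<Rightarrow> real" where
  "price M p j = W M (sellers M) (buyers M) (market_graph M p)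
               - W M (sellers M - {j}) (buyers M) (market_graph M p)"

text \<open>
  Several allocations may maximize welfare, and sellers' fees depend on which one is implemented.
  A clearing rule \<open>\<mu>\<close> is an arbitrary choice of one of them for each profile.
\<close>

definition clearing_rule ::
  "('b, 's, 'f) market \<Rightarrow> (('s \<Rightarrow> 'f set) \<Rightarrow> ('b \<times> 's) set) \<Rightarrow> bool" where
  "clearing_rule M \<mu> \<longleftrightarrow>
     (\<forall>p\<in>profiles M.
        \<mu> p \<in> matchings (sellers M) (buyers M) (market_graph M p) \<and>
        weight M (\<mu> p) = welfare M p)"

text \<open>
  A pair that is linked in \<open>direct M\<close> and also meets on a platform uses the direct link and pays
  no fee.
\<close>

definition transaction_fee ::
  "('b, 's, 'f) market \<Rightarrow> ('s \<Rightarrow> 'f set) \<Rightarrow> 'b \<Rightarrow> 's \<Rightarrow> real" where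
  "transaction_fee M p i j =
     (if (i, j) \<in> direct M then 0 else Min (fee M ` {r \<in> p j. i \<in> users M r}))"

definition utility ::
  "('b, 's, 'f) market \<Rightarrow> (('s \<Rightarrow> 'f set) \<Rightarrow> ('b \<times> 's) set) \<Rightarrow> ('s \<Rightarrow> 'f set) \<Rightarrow> 's \<Rightarrow> real" where
  "utility M \<mu> p j =
     (if \<exists>i. (i, j) \<in> \<mu> p
      then (1 - transaction_fee M p (THE i. (i, j) \<in> \<mu> p) j) * price M p j
      else 0)"

definition pure_platform_equilibrium ::
  "('b, 's, 'f) market \<Rightarrow> (('s \<Rightarrow> 'f set) \<Rightarrow> ('b \<times> 's) set) \<Rightarrow> ('s \<Rightarrow> 'f set) \<Rightarrow> bool" where
  "pure_platform_equilibrium M \<mu> p \<longleftrightarrow>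
     p \<in> profiles M \<and>
     (\<forall>j\<in>sellers M. \<forall>A. A \<subseteq> platforms M \<longrightarrow>
        utility M \<mu> (p(j := A)) j \<le> utility M \<mu> p j)"

definition play :: "('b, 's, 'f) market \<Rightarrow> ('s \<Rightarrow> 'f set pmf) \<Rightarrow> ('s \<Rightarrow> 'f set) pmf" where
  "play M \<sigma> = Pi_pmf (sellers M) {} \<sigma>"

definition expected_utility ::
  "('b, 's, 'f) market \<Rightarrow> (('s \<Rightarrow> 'f set) \<Rightarrow> ('b \<times> 's) set) \<Rightarrow> ('s \<Rightarrow> 'f set pmf) \<Rightarrow> 's \<Rightarrow> real"
where
  "expected_utility M \<mu> \<sigma> j = measure_pmf.expectation (play M \<sigma>) (\<lambda>p. utility M \<mu> p j)"

definition expected_welfare :: "('b, 's, 'f) market \<Rightarrow> ('s \<Rightarrow> 'f set pmf) \<Rightarrow> real" where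
  "expected_welfare M \<sigma> = measure_pmf.expectation (play M \<sigma>) (welfare M)"

definition mixed_platform_equilibrium ::
  "('b, 's, 'f) market \<Rightarrow> (('s \<Rightarrow> 'f set) \<Rightarrow> ('b \<times> 's) set) \<Rightarrow> ('s \<Rightarrow> 'f set pmf) \<Rightarrow> bool" where
  "mixed_platform_equilibrium M \<mu> \<sigma> \<longleftrightarrow>
     (\<forall>j\<in>sellers M. set_pmf (\<sigma> j) \<subseteq> Pow (platforms M)) \<and>
     (\<forall>j\<in>sellers M. \<forall>\<tau>. set_pmf \<tau> \<subseteq> Pow (platforms M) \<longrightarrow>
        expected_utility M \<mu> (\<sigma>(j := \<tau>)) j \<le> expected_utility M \<mu> \<sigma> j)"

end

theory Submission
  imports Defs
begin

text \<open>
  Let seller \<open>j\<close> deviate to joining every platform, and let \<open>i\<close> be its partner in an optimal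
  matching for the full graph. Rematching \<open>j\<close> to \<open>i\<close> in the current allocation \<open>\<mu> p\<close> destroys at
  most the current trades of \<open>i\<close> and of \<open>j\<close>. Writing \<open>w\<^sub>i\<close> and \<open>w\<^sub>j\<close> for the values of these
  trades, the price of \<open>j\<close> after the deviation is at least \<open>val i j - w\<^sub>i - w\<^sub>j\<close> plus its current
  price, and a fraction \<open>1 - \<alpha>\<close> of it is kept. The current utility of \<open>j\<close> is at most its price,
  hence at most \<open>w\<^sub>j\<close>, so the deviation gains at least \<open>(1 - \<alpha>) (val i j - w\<^sub>i) - w\<^sub>j\<close>. Summing
  over the optimal matching, the total gain is at least \<open>(1 - \<alpha>) W\<^sup>\<star> - (2 - \<alpha>) W\<close> pointwise in the
  profile, while in equilibrium it is nonpositive in expectation.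
\<close>

section \<open>Weights of edge sets and product distributions\<close>

lemma weight_Un_le:
  assumes "finite A" "finite B" "\<And>i j. (i, j) \<in> A \<inter> B \<Longrightarrow> 0 \<le> val M i j"
  shows "weight M (A \<union> B) \<le> weight M A + weight M B"
proof -
  have "weight M (A \<union> B) + weight M (A \<inter> B) = weight M A + weight M B"
    unfolding weight_def by (rule sum.union_inter[OF assms(1,2)])
  moreover have "0 \<le> weight M (A \<inter> B)"
    unfolding weight_def using assms(3) by (force intro!: sum_nonneg)
  ultimately show ?thesis by linarith
qed

text \<open>Distinct elements of \<open>n\<close> select disjoint fibres of \<open>h\<close> in
  \<open>m\<close>, so no element of \<open>m\<close> is counted twice. It is applied with
  \<open>fst\<close> and \<open>snd\<close>, where \<open>n\<close> is an optimal matching and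
  \<open>m\<close> the current allocation.\<close>

lemma sum_weight_fibres_le:
  assumes "finite m" "finite n" "inj_on h n" "\<And>i j. (i, j) \<in> m \<Longrightarrow> 0 \<le> val M i j"
  shows "(\<Sum>e\<in>n. weight M {e'\<in>m. h e' = h e}) \<le> weight M m"
proof -
  have nn: "0 \<le> weight M {e'\<in>m. h e' = x}" for x
    unfolding weight_def using assms(4) by (force intro!: sum_nonneg)
  have "(\<Sum>e\<in>n. weight M {e'\<in>m. h e' = h e}) = (\<Sum>x\<in>h ` n. weight M {e'\<in>m. h e' = x})"
    using assms(3) by (simp add: sum.reindex)
  \<comment> \<open>With the values of \<open>h\<close> on \<open>m\<close> included, the fibres
    partition \<open>m\<close>.\<close>
  also have "\<dots> \<le> (\<Sum>x\<in>h ` n \<union> h ` m. weight M {e'\<in>m. h e' = x})"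
    using assms(1,2) nn by (intro sum_mono2) auto
  also have "\<dots> = weight M m"
    unfolding weight_def using assms(1,2) by (intro sum.group) auto
  finally show ?thesis .
qed

text \<open>By independence, fixing coordinate \<open>x\<close> in advance and overwriting it after
  sampling leave the same product over \<open>I - {x}\<close>. This turns a deviation in a mixed
  profile into a pointwise deviation in the sampled pure profile.\<close>

lemma Pi_pmf_fun_upd_return:
  assumes "finite I" "x \<in> I"
  shows "Pi_pmf I d (\<sigma>(x := return_pmf a)) = map_pmf (\<lambda>f. f(x := a)) (Pi_pmf I d \<sigma>)"
proof -
  have I: "I = insert x (I - {x})" using assms by auto
  have "Pi_pmf I d (\<sigma>(x := return_pmf a)) =
      map_pmf (\<lambda>f. f(x := a)) (Pi_pmf (I - {x}) d (\<sigma>(x := return_pmf a)))"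
    using assms(1)
    by (subst I, subst Pi_pmf_insert)
       (auto simp: pair_return_pmf1 map_pmf_comp case_prod_beta')
  also have "Pi_pmf (I - {x}) d (\<sigma>(x := return_pmf a)) = Pi_pmf (I - {x}) d \<sigma>"
    using assms by (intro Pi_pmf_cong) auto
  also have "\<dots> = map_pmf (\<lambda>f. f(x := d)) (Pi_pmf I d \<sigma>)"
    by (rule Pi_pmf_remove[OF assms(1)])
  finally show ?thesis by (simp only: map_pmf_comp fun_upd_upd)
qed

locale cleared_market =
  fixes M :: "('b, 's, 'f) market" and \<alpha> :: real
    and \<mu> :: "('s \<Rightarrow> 'f set) \<Rightarrow> ('b \<times> 's) set"
  assumes alpha: "0 \<le> \<alpha>" "\<alpha> < 1"
    and capped: "capped_market \<alpha> M"
    and clearing: "clearing_rule M \<mu>"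
begin

section \<open>Matchings, maximum welfare and prices\<close>

lemma finite_buyers: "finite (buyers M)"
  and finite_sellers: "finite (sellers M)"
  and finite_platforms: "finite (platforms M)"
  and val_nonneg: "i \<in> buyers M \<Longrightarrow> j \<in> sellers M \<Longrightarrow> 0 \<le> val M i j"
  and fee_nonneg: "r \<in> platforms M \<Longrightarrow> 0 \<le> fee M r"
  and fee_le: "r \<in> platforms M \<Longrightarrow> fee M r \<le> \<alpha>"
  using capped by (auto simp: capped_market_def)

abbreviation "all_matchings \<equiv> matchings (sellers M) (buyers M)"

lemma matchings_mono: "S \<subseteq> S' \<Longrightarrow> E \<subseteq> E' \<Longrightarrow> matchings S B E \<subseteq> matchings S' B E'"
  by (auto simp: matchings_def)

lemma finite_matching: "m \<in> all_matchings E \<Longrightarrow> finite m"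
  using finite_subset[of m "buyers M \<times> sellers M"] finite_buyers finite_sellers
  by (auto simp: matchings_def)

lemma val_matching_nonneg: "m \<in> all_matchings E \<Longrightarrow> (i, j) \<in> m \<Longrightarrow> 0 \<le> val M i j"
  using val_nonneg by (auto simp: matchings_def)

lemma finite_matchings: "S \<subseteq> sellers M \<Longrightarrow> finite (matchings S (buyers M) E)"
  by (rule finite_subset[of _ "Pow (buyers M \<times> sellers M)"])
     (auto simp: matchings_def finite_buyers finite_sellers)

lemma weight_le_W:
  assumes "S \<subseteq> sellers M" "m \<in> matchings S (buyers M) E"
  shows "weight M m \<le> W M S (buyers M) E"
  unfolding W_def using finite_matchings[OF assms(1)] assms(2) by simp

lemma W_attained:
  assumes "S \<subseteq> sellers M"
  obtains m where "m \<in> matchings S (buyers M) E" "weight M m = W M S (buyers M) E"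
proof -
  have "{} \<in> matchings S (buyers M) E" by (simp add: matchings_def)
  then have "W M S (buyers M) E \<in> weight M ` matchings S (buyers M) E"
    unfolding W_def using finite_matchings[OF assms] by (intro Max_in) auto
  then show ?thesis using that by auto
qed

lemma price_nonneg: "0 \<le> price M p j"
proof -
  obtain m where "m \<in> matchings (sellers M - {j}) (buyers M) (market_graph M p)"
    "weight M m = W M (sellers M - {j}) (buyers M) (market_graph M p)"
    using W_attained[of "sellers M - {j}" "market_graph M p"] by auto
  moreover from this(1) have "m \<in> all_matchings (market_graph M p)"
    using matchings_mono[of "sellers M - {j}" "sellers M"] by blast
  ultimately show ?thesis using weight_le_W[of "sellers M" m] by (auto simp: price_def)
qed

lemma
  assumes "p \<in> profiles M"
  shows clearing_matching: "\<mu> p \<in> all_matchings (market_graph M p)"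
    and clearing_weight: "weight M (\<mu> p) = welfare M p"
  using clearing assms by (auto simp: clearing_rule_def)

text \<open>Deleting the trade of \<open>j\<close> from \<open>\<mu> p\<close> leaves a matching of
  the market without \<open>j\<close>, so removing \<open>j\<close> costs at most the value of that
  trade.\<close>

lemma price_le_trade:
  assumes p: "p \<in> profiles M"
  shows "price M p j \<le> weight M {e \<in> \<mu> p. snd e = j}"
proof -
  let ?A = "{e \<in> \<mu> p. snd e = j}" and ?B = "{e \<in> \<mu> p. snd e \<noteq> j}"
  have fin: "finite (\<mu> p)" using clearing_matching[OF p] finite_matching by blast
  have "\<mu> p = ?A \<union> ?B" by auto
  then have "weight M (\<mu> p) \<le> weight M ?A + weight M ?B"
    using weight_Un_le[of ?A ?B M] fin by auto
  moreover have "?B \<in> matchings (sellers M - {j}) (buyers M) (market_graph M p)"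
    using clearing_matching[OF p] by (auto simp: matchings_def inj_on_def)
  then have "weight M ?B \<le> W M (sellers M - {j}) (buyers M) (market_graph M p)"
    by (intro weight_le_W) auto
  ultimately show ?thesis
    using clearing_weight[OF p] by (simp add: price_def welfare_def)
qed

lemma profile_subset: "p \<in> profiles M \<Longrightarrow> p j \<subseteq> platforms M"
  by (cases "j \<in> sellers M") (auto simp: profiles_def PiE_dflt_def)

lemma transaction_fee_bounds:
  assumes "p \<in> profiles M" "(i, j) \<in> market_graph M p"
  shows "0 \<le> transaction_fee M p i j" "transaction_fee M p i j \<le> \<alpha>"
proof -
  let ?R = "{r \<in> p j. i \<in> users M r}"
  have sub: "?R \<subseteq> platforms M" using profile_subset[OF assms(1)] by auto
  then have fin: "finite ?R" using finite_platforms finite_subset by blast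
  \<comment> \<open>An edge that is not direct stems from a joined platform, so the minimum is over
    a nonempty set.\<close>
  have *: "Min (fee M ` ?R) \<in> fee M ` ?R" if "(i, j) \<notin> direct M"
    using that assms(2) fin by (intro Min_in) (auto simp: market_graph_def)
  show "0 \<le> transaction_fee M p i j" "transaction_fee M p i j \<le> \<alpha>"
    using * alpha fee_nonneg[OF subsetD[OF sub]] fee_le[OF subsetD[OF sub]]
    by (auto simp: transaction_fee_def)
qed

lemma utility_bounds:
  assumes p: "p \<in> profiles M"
  shows "(1 - \<alpha>) * price M p j \<le> utility M \<mu> p j" "utility M \<mu> p j \<le> price M p j"
proof -
  have "(1 - \<alpha>) * price M p j \<le> utility M \<mu> p j \<and> utility M \<mu> p j \<le> price M p j"
  proof (cases "\<exists>i. (i, j) \<in> \<mu> p")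
    case True
    then obtain i where i: "(i, j) \<in> \<mu> p" by auto
    have inj: "inj_on snd (\<mu> p)" using clearing_matching[OF p] by (simp add: matchings_def)
    have "i' = i" if "(i', j) \<in> \<mu> p" for i'
      using inj_onD[OF inj _ that i] by simp
    then have "(THE i. (i, j) \<in> \<mu> p) = i" using i by blast
    then have "utility M \<mu> p j = (1 - transaction_fee M p i j) * price M p j"
      using i by (auto simp: utility_def)
    moreover have "(i, j) \<in> market_graph M p"
      using i clearing_matching[OF p] by (auto simp: matchings_def)
    note transaction_fee_bounds[OF p this]
    ultimately show ?thesis
      using price_nonneg[of p j] alpha by (auto intro!: mult_right_mono mult_left_le_one_le)
  next
    case False
    \<comment> \<open>The utility is 0 without a trade, so the lower bound requires the price to
      vanish as well.\<close>
    then have "weight M {e \<in> \<mu> p. snd e = j} = 0"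
      unfolding weight_def by (intro sum.neutral) auto
    then have "price M p j = 0"
      using price_le_trade[OF p, of j] price_nonneg[of p j] by linarith
    with False show ?thesis by (simp add: utility_def)
  qed
  then show "(1 - \<alpha>) * price M p j \<le> utility M \<mu> p j" "utility M \<mu> p j \<le> price M p j"
    by auto
qed

section \<open>The deviation to all platforms\<close>

abbreviation join_all :: "('s \<Rightarrow> 'f set) \<Rightarrow> 's \<Rightarrow> 's \<Rightarrow> 'f set" where
  "join_all p j \<equiv> p(j := platforms M)"

lemma price_join_all:
  assumes p: "p \<in> profiles M" and j: "j \<in> sellers M" and i: "i \<in> buyers M"
    and ij: "(i, j) \<in> market_graph M (\<lambda>_. platforms M)"
  shows "price M (join_all p j) j \<ge> val M i j - weight M {e \<in> \<mu> p. fst e = i}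
           - weight M {e \<in> \<mu> p. snd e = j} + price M p j"
proof -
  let ?A = "{e \<in> \<mu> p. fst e = i}" and ?B = "{e \<in> \<mu> p. snd e = j}"
  let ?C = "{e \<in> \<mu> p. fst e \<noteq> i \<and> snd e \<noteq> j}"
  let ?E = "market_graph M p" and ?E' = "market_graph M (join_all p j)"
  note match = clearing_matching[OF p]
  have fin: "finite (\<mu> p)" using match finite_matching by blast
  have "weight M (\<mu> p) = weight M ((?A \<union> ?B) \<union> ?C)"
    by (rule arg_cong[of _ _ "weight M"]) auto
  also have "\<dots> \<le> weight M (?A \<union> ?B) + weight M ?C"
    using fin by (intro weight_Un_le) auto
  \<comment> \<open>If \<open>i\<close> and \<open>j\<close> currently trade with each other, their
    trade lies in both sets; its value is nonnegative.\<close>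
  also have "weight M (?A \<union> ?B) \<le> weight M ?A + weight M ?B"
    using fin val_matching_nonneg[OF match] by (intro weight_Un_le) auto
  finally have rest: "welfare M p \<le> weight M ?A + weight M ?B + weight M ?C"
    using clearing_weight[OF p] by simp
  have E: "?E \<subseteq> ?E'"
    using profile_subset[OF p] by (fastforce simp: market_graph_def)
  have "(i, j) \<in> ?E'" using ij by (auto simp: market_graph_def)
  then have "insert (i, j) ?C \<in> all_matchings ?E'"
    using match E i j by (auto simp: matchings_def inj_on_def)
  then have "weight M (insert (i, j) ?C) \<le> W M (sellers M) (buyers M) ?E'"
    by (intro weight_le_W) auto
  moreover have "weight M (insert (i, j) ?C) = val M i j + weight M ?C"
    using fin by (simp add: weight_def)
  \<comment> \<open>The deviation changes edges at \<open>j\<close> only, so the subtracted terms of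
    the two prices agree.\<close>
  moreover have "matchings (sellers M - {j}) (buyers M) ?E' =
      matchings (sellers M - {j}) (buyers M) ?E"
    by (auto simp: matchings_def market_graph_def split: if_splits)
  then have "W M (sellers M - {j}) (buyers M) ?E' = W M (sellers M - {j}) (buyers M) ?E"
    by (simp add: W_def)
  ultimately show ?thesis using rest by (simp add: price_def welfare_def)
qed

lemma join_all_profile: "p \<in> profiles M \<Longrightarrow> j \<in> sellers M \<Longrightarrow> join_all p j \<in> profiles M"
  by (auto simp: profiles_def PiE_dflt_def)

lemma gain_join_all:
  assumes p: "p \<in> profiles M" and j: "j \<in> sellers M" and i: "i \<in> buyers M"
    and ij: "(i, j) \<in> market_graph M (\<lambda>_. platforms M)"
  shows "utility M \<mu> (join_all p j) j - utility M \<mu> p j \<ge>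
    (1 - \<alpha>) * (val M i j - weight M {e \<in> \<mu> p. fst e = i}) - weight M {e \<in> \<mu> p. snd e = j}"
proof -
  let ?v = "val M i j - weight M {e \<in> \<mu> p. fst e = i}" and ?w = "weight M {e \<in> \<mu> p. snd e = j}"
  have "(1 - \<alpha>) * (?v - ?w + price M p j) \<le> (1 - \<alpha>) * price M (join_all p j) j"
    using price_join_all[OF assms] alpha by (intro mult_left_mono) auto
  also have "\<dots> \<le> utility M \<mu> (join_all p j) j"
    by (rule utility_bounds(1)[OF join_all_profile[OF p j]])
  finally have "(1 - \<alpha>) * (?v - ?w + price M p j) - price M p j \<le>
      utility M \<mu> (join_all p j) j - utility M \<mu> p j"
    using utility_bounds(2)[OF p, of j] by linarith
  \<comment> \<open>The previous lower bound equals \<open>(1 - \<alpha>) * ?v - ?w\<close> plus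
    \<open>\<alpha> * (?w - price M p j)\<close>, and this last term is nonnegative.\<close>
  moreover have "\<alpha> * price M p j \<le> \<alpha> * ?w"
    using price_le_trade[OF p] alpha by (intro mult_left_mono) auto
  ultimately show ?thesis by (simp add: algebra_simps)
qed

text \<open>Each buyer and each seller occurs at most once in \<open>n\<close>, so the lost buyer
  trades and the lost seller trades each sum to at most \<open>welfare M p\<close>. Their
  coefficients \<open>1 - \<alpha>\<close> and \<open>1\<close> add up to
  \<open>2 - \<alpha>\<close>.\<close>

lemma sum_gain_join_all:
  assumes p: "p \<in> profiles M" and n: "n \<in> all_matchings (market_graph M (\<lambda>_. platforms M))"
  shows "(\<Sum>(i, j)\<in>n. utility M \<mu> (join_all p j) j - utility M \<mu> p j) \<ge>
    (1 - \<alpha>) * weight M n - (2 - \<alpha>) * welfare M p"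
proof -
  have fin: "finite n" "finite (\<mu> p)"
    using n clearing_matching[OF p] finite_matching by blast+
  let ?b = "\<Sum>e\<in>n. weight M {e'\<in>\<mu> p. fst e' = fst e}"
  let ?s = "\<Sum>e\<in>n. weight M {e'\<in>\<mu> p. snd e' = snd e}"
  have "?b \<le> welfare M p" "?s \<le> welfare M p"
    using sum_weight_fibres_le[of "\<mu> p" n] fin n val_matching_nonneg[OF clearing_matching[OF p]]
    by (auto simp: matchings_def clearing_weight[OF p, symmetric])
  then have "(1 - \<alpha>) * ?b + ?s \<le> (1 - \<alpha>) * welfare M p + welfare M p"
    using alpha by (intro add_mono mult_left_mono) auto
  then have "(1 - \<alpha>) * weight M n - (2 - \<alpha>) * welfare M p \<le>
      (1 - \<alpha>) * (weight M n - ?b) - ?s"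
    by (simp add: algebra_simps)
  also have "\<dots> = (\<Sum>(i, j)\<in>n. (1 - \<alpha>) * (val M i j - weight M {e \<in> \<mu> p. fst e = i})
      - weight M {e \<in> \<mu> p. snd e = j})"
    by (simp add: weight_def[of M n] case_prod_beta sum_subtractf sum_distrib_left[symmetric])
  also have "\<dots> \<le> (\<Sum>(i, j)\<in>n. utility M \<mu> (join_all p j) j - utility M \<mu> p j)"
    using n gain_join_all[OF p] by (intro sum_mono) (auto simp: matchings_def)
  finally show ?thesis .
qed

section \<open>Price of Anarchy for pure and mixed equilibria\<close>

lemma poa_bound:
  assumes "(1 - \<alpha>) * x \<le> (2 - \<alpha>) * y"
  shows "x \<le> (2 - \<alpha>) / (1 - \<alpha>) * y"
  using assms alpha by (simp add: field_simps)

lemma pure_poa: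
  assumes eq: "pure_platform_equilibrium M \<mu> p"
  shows "optimal_welfare M \<le> (2 - \<alpha>) / (1 - \<alpha>) * welfare M p"
proof -
  obtain n where n: "n \<in> all_matchings (market_graph M (\<lambda>_. platforms M))"
    "weight M n = optimal_welfare M"
    using W_attained[of "sellers M"] unfolding optimal_welfare_def by blast
  have seller: "j \<in> sellers M" if "(i, j) \<in> n" for i j
    using that n(1) by (auto simp: matchings_def)
  have "(\<Sum>(i, j)\<in>n. utility M \<mu> (join_all p j) j - utility M \<mu> p j) \<le> 0"
    using eq seller by (force simp: pure_platform_equilibrium_def intro!: sum_nonpos)
  with sum_gain_join_all[OF _ n(1), of p] eq n(2) show ?thesis
    by (intro poa_bound) (auto simp: pure_platform_equilibrium_def)
qed

lemma mixed_poa: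
  assumes eq: "mixed_platform_equilibrium M \<mu> \<sigma>"
  shows "optimal_welfare M \<le> (2 - \<alpha>) / (1 - \<alpha>) * expected_welfare M \<sigma>"
proof -
  obtain n where n: "n \<in> all_matchings (market_graph M (\<lambda>_. platforms M))"
    "weight M n = optimal_welfare M"
    using W_attained[of "sellers M"] unfolding optimal_welfare_def by blast
  have seller: "j \<in> sellers M" if "(i, j) \<in> n" for i j
    using that n(1) by (auto simp: matchings_def)
  let ?gain = "\<lambda>p j. utility M \<mu> (join_all p j) j - utility M \<mu> p j"
  have supp: "set_pmf (play M \<sigma>) \<subseteq> profiles M"
    using eq finite_sellers
    by (auto simp: play_def set_Pi_pmf profiles_def PiE_dflt_def mixed_platform_equilibrium_def)
  \<comment> \<open>Finite support makes every function of the profile integrable.\<close>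
  have "finite (profiles M)"
    unfolding profiles_def using finite_sellers finite_platforms by (intro finite_PiE_dflt) auto
  with supp have fin: "finite (set_pmf (play M \<sigma>))" by (rule finite_subset)
  note int [simp] = integrable_measure_pmf_finite[OF fin]
  have gain: "measure_pmf.expectation (play M \<sigma>) (\<lambda>p. ?gain p j) \<le> 0" if j: "j \<in> sellers M" for j
  proof -
    \<comment> \<open>Joining every platform does not depend on the sampled choices of the others,
      so it is an admissible strategy, namely a point mass.\<close>
    have "expected_utility M \<mu> (\<sigma>(j := return_pmf (platforms M))) j \<le> expected_utility M \<mu> \<sigma> j"
      using eq j by (auto simp: mixed_platform_equilibrium_def)
    moreover have "expected_utility M \<mu> (\<sigma>(j := return_pmf (platforms M))) j =
        measure_pmf.expectation (play M \<sigma>) (\<lambda>p. utility M \<mu> (join_all p j) j)"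
      by (simp add: expected_utility_def play_def Pi_pmf_fun_upd_return[OF finite_sellers j])
    ultimately show ?thesis by (simp add: expected_utility_def)
  qed
  have "(1 - \<alpha>) * optimal_welfare M - (2 - \<alpha>) * expected_welfare M \<sigma> =
      measure_pmf.expectation (play M \<sigma>)
        (\<lambda>p. (1 - \<alpha>) * optimal_welfare M - (2 - \<alpha>) * welfare M p)"
    by (simp add: expected_welfare_def)
  also have "\<dots> \<le> measure_pmf.expectation (play M \<sigma>) (\<lambda>p. \<Sum>e\<in>n. ?gain p (snd e))"
    using sum_gain_join_all[OF _ n(1)] supp n(2)
    by (intro integral_mono_AE) (auto simp: AE_measure_pmf_iff case_prod_beta)
  \<comment> \<open>The matching \<open>n\<close> is the same for all profiles, so sum and
    expectation can be exchanged.\<close>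
  also have "\<dots> = (\<Sum>e\<in>n. measure_pmf.expectation (play M \<sigma>) (\<lambda>p. ?gain p (snd e)))"
    by (rule Bochner_Integration.integral_sum) simp
  also have "\<dots> \<le> 0"
    using seller by (intro sum_nonpos gain) auto
  finally show ?thesis by (intro poa_bound) simp
qed

end

theorem theorem6p1:
  fixes M :: "('b, 's, 'f) market" and \<alpha> :: real
    and \<mu> :: "('s \<Rightarrow> 'f set) \<Rightarrow> ('b \<times> 's) set"
  assumes "0 \<le> \<alpha>" and "\<alpha> < 1"
    and "capped_market \<alpha> M"
    and "clearing_rule M \<mu>"
  shows "(\<forall>p. pure_platform_equilibrium M \<mu> p \<longrightarrow>
            optimal_welfare M \<le> (2 - \<alpha>) / (1 - \<alpha>) * welfare M p) \<and>
         (\<forall>\<sigma>. mixed_platform_equilibrium M \<mu> \<sigma> \<longrightarrow>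
            optimal_welfare M \<le> (2 - \<alpha>) / (1 - \<alpha>) * expected_welfare M \<sigma>)"
proof -
  interpret cleared_market M \<alpha> \<mu>
    using assms by unfold_locales
  show ?thesis using pure_poa mixed_poa by blast
qed

end
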